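(* Let $\Omega\subset\mathbb{R}^d$ be a measurable set of finite Lebesgue measure and suppose that there exists $R>0$ such that $|\Omega\cap(\Omega+x)|>0$ for all $x\in\mathbb{R}^d$ with $|x|>R$. Then $L^2(\Omega)$ does not admit any tight Fourier frame.
   Context: $|\Omega|$ denotes Lebesgue measure (and $|x|$ the Euclidean norm of $x\in\mathbb{R}^d$). A tight Fourier frame for $L^2(\Omega)$ is a system $\{e^{2\pi i\langle\lambda,\cdot\rangle}\}_{\lambda\in\Lambda}$ with $\Lambda\subset\mathbb{R}^d$ countable for which there is a constant $0<A<\infty$ with $$\sum_{\lambda\in\Lambda}\left|\int_\Omega f(x)e^{-2\pi i\langle\lambda,x\rangle}dx\right|^2=A\int_\Omega|f(x)|^2dx\quad\text{for all }f\in L^2(\Omega).$$ *)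

theory Defs
  imports "HOL-Analysis.Analysis"
begin

text \<open>Representatives of the elements of the complex space \<open>L\<^sup>2(\<Omega>)\<close>; functions are not identified
  when they agree almost everywhere, and their values outside \<open>\<Omega>\<close> are irrelevant.\<close>

definition L2_functions :: "(real ^ 'd) set \<Rightarrow> (real ^ 'd \<Rightarrow> complex) set" where
  "L2_functions \<Omega> = {f. f \<in> borel_measurable (lebesgue_on \<Omega>) \<and>
                        integrable (lebesgue_on \<Omega>) (\<lambda>x. (norm (f x))\<^sup>2)}"

text \<open>The integral below is a Bochner integral, which is 0 by convention if the integrand is not
  integrable. For \<open>f\<close> in \<open>L\<^sup>2(\<Omega>)\<close> with \<open>\<Omega>\<close> of finite measure the integrand is always integrable.\<close>

definition fourier_coeff :: "(real ^ 'd) set \<Rightarrow> (real ^ 'd \<Rightarrow> complex) \<Rightarrow> real ^ 'd \<Rightarrow> complex" where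
  "fourier_coeff \<Omega> f l =
     (LINT x|lebesgue_on \<Omega>. f x * exp (- 2 * complex_of_real pi * \<i> * complex_of_real (l \<bullet> x)))"

text \<open>The identity is stated with \<open>has_sum\<close>, so it includes convergence of the sum over \<open>\<Lambda>\<close>.\<close>

definition tight_fourier_frame :: "(real ^ 'd) set \<Rightarrow> (real ^ 'd) set \<Rightarrow> bool" where
  "tight_fourier_frame \<Omega> \<Lambda> \<longleftrightarrow>
     countable \<Lambda> \<and>
     (\<exists>A::real. 0 < A \<and>
        (\<forall>f \<in> L2_functions \<Omega>.
           ((\<lambda>l. (norm (fourier_coeff \<Omega> f l))\<^sup>2) has_sum
              (A * (LINT x|lebesgue_on \<Omega>. (norm (f x))\<^sup>2))) \<Lambda>))"

end

theory Submission
  imports Defs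
begin

text \<open>On functions \<open>u, v\<close> supported in a common translate of \<open>\<Omega>\<close> the forms
  \<open>\<Sum>l\<in>\<Lambda>. ft u l * cnj (ft v l)\<close> and \<open>A * (LINT x. u x * cnj (v x))\<close> agree, since a translation changes
  each coefficient only by a unimodular factor that is the same for \<open>u\<close> and \<open>v\<close>. If
  \<open>\<Omega> \<inter> (\<Omega> + (x - y))\<close> has positive measure, then some translate of \<open>\<Omega>\<close> nearly contains given
  functions living on sufficiently small balls around \<open>x\<close> and \<open>y\<close>, and a contraction argument gives
  the identity for all such functions. By compactness, functions whose supports are more than \<open>R\<close>
  apart are therefore orthogonal for the first form. Summing \<open>n\<close> far apart, suitably modulated
  translates of one function \<open>u\<close> multiplies \<open>ft u l\<close> by \<open>n\<close>, but the sum of the squares of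
  all coefficients only by \<open>n\<close>; hence \<open>ft u l = 0\<close> for all \<open>l \<in> \<Lambda>\<close>, which is absurd.\<close>

section \<open>Bounded Borel functions with bounded support\<close>

text \<open>Borel rather than Lebesgue measurability, so that Tonelli's theorem applies to \<open>u (x + s)\<close>
  on the product space.\<close>

definition bdd_fun_on :: "'a::euclidean_space set \<Rightarrow> ('a \<Rightarrow> 'b::real_normed_vector) \<Rightarrow> bool" where
  "bdd_fun_on S u \<longleftrightarrow> u \<in> borel_measurable borel \<and> bounded (range u) \<and>
     bounded {x. u x \<noteq> 0} \<and> {x. u x \<noteq> 0} \<subseteq> S"

lemma bdd_fun_on_mono: "bdd_fun_on S u \<Longrightarrow> S \<subseteq> S' \<Longrightarrow> bdd_fun_on S' u"
  by (auto simp: bdd_fun_on_def)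

lemma bdd_fun_on_measurable [measurable_dest]: "bdd_fun_on S u \<Longrightarrow> u \<in> borel_measurable borel"
  by (simp add: bdd_fun_on_def)

lemma bdd_fun_on_eq_0: "bdd_fun_on S u \<Longrightarrow> x \<notin> S \<Longrightarrow> u x = 0"
  by (auto simp: bdd_fun_on_def)

text \<open>The inequality passes both the bound and the support of \<open>u\<close> on to
  \<open>f\<close>, so that most closure properties below reduce to an estimate and measurability.
  The sign of \<open>C\<close> is left open, hence \<open>\<bar>C\<bar>\<close> in the
  proof.\<close>

lemma bdd_fun_on_dominated:
  assumes u: "bdd_fun_on S u" and f: "f \<in> borel_measurable borel"
    and le: "\<And>x. norm (f x) \<le> C * norm (u x)"
  shows "bdd_fun_on S f"
proof -
  obtain B where B: "\<And>x. norm (u x) \<le> B"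
    using u by (auto simp: bdd_fun_on_def bounded_iff)
  have "norm (f x) \<le> \<bar>C\<bar> * B" for x
  proof -
    have "norm (f x) \<le> \<bar>C\<bar> * norm (u x)"
      by (rule order_trans[OF le]) (simp add: mult_right_mono)
    also have "\<dots> \<le> \<bar>C\<bar> * B" by (simp add: B mult_left_mono)
    finally show ?thesis .
  qed
  then have "bounded (range f)"
    by (auto simp: bounded_iff)
  moreover have "{x. f x \<noteq> 0} \<subseteq> {x. u x \<noteq> 0}"
  proof
    fix x assume "x \<in> {x. f x \<noteq> 0}"
    then show "x \<in> {x. u x \<noteq> 0}" using le[of x] by auto
  qed
  ultimately show ?thesis
    using u f bounded_subset[of "{x. u x \<noteq> 0}" "{x. f x \<noteq> 0}"]
    unfolding bdd_fun_on_def by blast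
qed

lemma bdd_fun_on_add:
  assumes u: "bdd_fun_on S u" and v: "bdd_fun_on S v"
  shows "bdd_fun_on S (\<lambda>x. u x + v x :: 'b::{real_normed_vector, second_countable_topology})"
proof -
  obtain B C where "\<And>x. norm (u x) \<le> B" "\<And>x. norm (v x) \<le> C"
    using u v by (auto simp: bdd_fun_on_def bounded_iff)
  then have "norm (u x + v x) \<le> B + C" for x
    by (meson add_mono norm_triangle_le)
  then have "bounded (range (\<lambda>x. u x + v x))"
    by (auto simp: bounded_iff)
  moreover have "bounded ({x. u x \<noteq> 0} \<union> {x. v x \<noteq> 0})"
    using u v by (simp add: bdd_fun_on_def)
  then have "bounded {x. u x + v x \<noteq> 0}"
    by (rule bounded_subset) auto
  moreover have "{x. u x + v x \<noteq> 0} \<subseteq> S"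
    using bdd_fun_on_eq_0[OF u] bdd_fun_on_eq_0[OF v] by fastforce
  moreover have "(\<lambda>x. u x + v x) \<in> borel_measurable borel"
    using u v by (intro borel_measurable_add bdd_fun_on_measurable)
  ultimately show ?thesis
    unfolding bdd_fun_on_def by simp
qed

lemma bdd_fun_on_scale: "bdd_fun_on S u \<Longrightarrow> bdd_fun_on S (\<lambda>x. c * u x :: complex)"
  by (rule bdd_fun_on_dominated[where C = "norm c"]) (auto simp: norm_mult)

lemma bdd_fun_on_norm_power2:
  fixes u :: "'a::euclidean_space \<Rightarrow> complex"
  assumes u: "bdd_fun_on S u"
  shows "bdd_fun_on S (\<lambda>x. (norm (u x))\<^sup>2)"
proof -
  obtain B where "\<And>x. norm (u x) \<le> B"
    using u by (auto simp: bdd_fun_on_def bounded_iff)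
  then have "norm ((norm (u x))\<^sup>2) \<le> B * norm (u x)" for x
    by (simp add: power2_eq_square mult_right_mono)
  with u show ?thesis
    by (intro bdd_fun_on_dominated[OF u]) auto
qed

lemma bdd_fun_on_restrict:
  fixes u :: "'a::euclidean_space \<Rightarrow> 'b::{real_normed_algebra_1, second_countable_topology}"
  assumes u: "bdd_fun_on S u" and "T \<in> sets borel"
  shows "bdd_fun_on (S \<inter> T) (\<lambda>x. u x * indicator T x)"
proof -
  have "bdd_fun_on S (\<lambda>x. u x * indicator T x)"
  proof (rule bdd_fun_on_dominated[OF u])
    show "(\<lambda>x. u x * indicator T x) \<in> borel_measurable borel"
      using assms by (intro borel_measurable_times bdd_fun_on_measurable borel_measurable_indicator)
    show "norm (u x * indicator T x) \<le> 1 * norm (u x)" for x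
      by (simp add: indicator_def)
  qed
  moreover have "{x. u x * indicator T x \<noteq> 0} \<subseteq> T"
    by (auto simp: indicator_def)
  ultimately show ?thesis
    by (simp add: bdd_fun_on_def)
qed

lemma bdd_fun_on_translate:
  fixes u :: "'a::euclidean_space \<Rightarrow> complex"
  assumes u: "bdd_fun_on S u"
  shows "bdd_fun_on ((\<lambda>x. x + t) ` S) (\<lambda>x. u (x - t))"
proof -
  have eq: "{x. u (x - t) \<noteq> 0} = (\<lambda>x. x + t) ` {x. u x \<noteq> 0}"
    by (auto simp: image_iff intro!: exI[of _ "_ - t"])
  have "(\<lambda>x. x + t) = (+) t" by auto
  then have "bounded {x. u (x - t) \<noteq> 0}"
    using u unfolding eq bdd_fun_on_def by (metis bounded_translation)
  moreover have "bounded (range (\<lambda>x. u (x - t)))"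
    by (rule bounded_subset[of "range u"]) (use u in \<open>auto simp: bdd_fun_on_def\<close>)
  ultimately show ?thesis
    using u unfolding bdd_fun_on_def eq by auto
qed

lemma bdd_fun_on_integrable:
  fixes u :: "'a::euclidean_space \<Rightarrow> 'b::{banach, second_countable_topology}"
  assumes u: "bdd_fun_on S u"
  shows "integrable lborel u"
proof -
  obtain B where B: "\<And>x. norm (u x) \<le> B"
    using u by (auto simp: bdd_fun_on_def bounded_iff)
  obtain K where K: "{x. u x \<noteq> 0} \<subseteq> cball 0 K"
    using u bounded_subset_cball[of "{x. u x \<noteq> 0}"] bounded_any_center[of _ "0::'a"]
    unfolding bdd_fun_on_def by (metis mem_cball subsetI)
  show ?thesis
  proof (rule integrableI_bounded_set[where A = "cball 0 K" and B = B])
    show "AE x in lborel. x \<in> cball 0 K \<longrightarrow> norm (u x) \<le> B"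
      using B by simp
    show "AE x in lborel. x \<notin> cball 0 K \<longrightarrow> u x = 0"
      using K by (intro AE_I2) blast
    show "emeasure lborel (cball 0 K) < \<infinity>"
      by (rule emeasure_lborel_cball_finite)
  qed (use u in \<open>auto simp: bdd_fun_on_def\<close>)
qed

lemma bdd_fun_on_integrable_mult:
  fixes u v :: "'a::euclidean_space \<Rightarrow> complex"
  assumes u: "bdd_fun_on S u" and v: "bdd_fun_on S' v"
  shows "integrable lborel (\<lambda>x. u x * cnj (v x))"
proof -
  obtain B where "\<And>x. norm (v x) \<le> B"
    using v by (auto simp: bdd_fun_on_def bounded_iff)
  then have "norm (u x * cnj (v x)) \<le> B * norm (u x)" for x
    by (simp add: norm_mult mult.commute[of B] mult_left_mono)
  moreover have "(\<lambda>x. u x * cnj (v x)) \<in> borel_measurable borel"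
    using u v
    by (intro borel_measurable_times bdd_fun_on_measurable
        measurable_compose[OF bdd_fun_on_measurable borel_measurable_continuous_onI] continuous_intros)
  ultimately have "bdd_fun_on S (\<lambda>x. u x * cnj (v x))"
    by (intro bdd_fun_on_dominated[OF u])
  then show ?thesis
    by (rule bdd_fun_on_integrable)
qed

lemma lborel_integral_translate:
  fixes f :: "'a::euclidean_space \<Rightarrow> 'b::{banach, second_countable_topology}"
  assumes [measurable]: "f \<in> borel_measurable borel"
  shows "(LINT x|lborel. f (x - t)) = (LINT x|lborel. f x)"
proof -
  have "(LINT x|lborel. f x) = (LINT x|distr lborel borel ((+) (-t)). f x)"
    by (simp add: lborel_distr_plus)
  also have "\<dots> = (LINT x|lborel. f (- t + x))"
    by (rule integral_distr) auto
  finally show ?thesis by simp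
qed

section \<open>Shifting functions into \<open>\<Omega>\<close>\<close>

text \<open>Smallness is measured after averaging against an arbitrary density \<open>g\<close>, because the shift
  \<open>s\<close> has to be chosen depending on the functions it is applied to. The constant \<open>1/16\<close> is what makes
  the recursions in \<open>bessel\<close> and \<open>D_nearly_covered\<close> contract by a factor \<open>1/2\<close>.\<close>

definition nearly_covered :: "'a::euclidean_space set \<Rightarrow> 'a set \<Rightarrow> bool" where
  "nearly_covered \<Omega> S \<longleftrightarrow>
     (\<forall>g::'a \<Rightarrow> real. bdd_fun_on S g \<longrightarrow> (\<forall>x. 0 \<le> g x) \<longrightarrow>
       (\<exists>T\<in>sets borel. \<exists>s. (\<forall>x\<in>T. x + s \<in> \<Omega>) \<and>
          16 * (LINT x|lborel. g x * indicator (- T) x) \<le> (LINT x|lborel. g x)))"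

lemma nearly_covered_mono: "nearly_covered \<Omega> S \<Longrightarrow> S' \<subseteq> S \<Longrightarrow> nearly_covered \<Omega> S'"
  unfolding nearly_covered_def by (meson bdd_fun_on_mono)

text \<open>Outer regularity gives an open \<open>U\<close> around \<open>G\<close> with
  \<open>U - G\<close> small. As \<open>G\<close> has positive distance to the complement of
  \<open>U\<close>, a short shift keeps \<open>G\<close> inside \<open>U\<close>, so a point that
  leaves \<open>G\<close> lands in \<open>U - G\<close>.\<close>

lemma compact_translate_small:
  fixes G :: "'a::euclidean_space set"
  assumes "compact G" and "0 < e"
  obtains r where "0 < r"
    and "\<And>h. norm h < r \<Longrightarrow> emeasure lborel {z \<in> G. z + h \<notin> G} \<le> ennreal e"
proof -
  have G: "G \<in> lmeasurable" "G \<in> sets borel"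
    using assms by (auto simp: lmeasurable_compact borel_compact)
  obtain U where U: "open U" "G \<subseteq> U" "U - G \<in> lmeasurable" "emeasure lebesgue (U - G) < ennreal e"
    using sets_lebesgue_outer_open[of G e] G assms by (metis fmeasurableD)
  obtain r where r: "0 < r" "\<And>x y. x \<in> G \<Longrightarrow> y \<notin> U \<Longrightarrow> r \<le> dist x y"
    using separate_compact_closed[of G "- U"] U assms that
    by (metis ComplI Compl_disjoint closed_Compl disjoint_eq_subset_Compl double_complement)
  show thesis
  proof
    fix h :: 'a assume h: "norm h < r"
    have "emeasure lborel {z \<in> G. z + h \<notin> G} \<le> emeasure lborel ((+) h -` (U - G))"
    proof (rule emeasure_mono)
      show "{z \<in> G. z + h \<notin> G} \<subseteq> (+) h -` (U - G)"
        using r(2) h by (force simp: dist_norm add.commute)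
      show "(+) h -` (U - G) \<in> sets lborel"
        using G U measurable_sets_borel[of "(+) h" borel "U - G"] by simp
    qed
    also have "\<dots> = emeasure (distr lborel borel ((+) h)) (U - G)"
      using G U by (subst emeasure_distr) auto
    also have "\<dots> = emeasure lebesgue (U - G)"
      using G U by (simp add: lborel_distr_plus emeasure_completion)
    finally show "emeasure lborel {z \<in> G. z + h \<notin> G} \<le> ennreal e"
      using U by simp
  qed fact
qed

text \<open>A closed subset that misses less than the full measure of \<open>W\<close> is not null,
  and so neither are all its intersections with balls around 0, which are compact.\<close>

lemma compact_positive_measure_subset:
  fixes W :: "'a::euclidean_space set"
  assumes W: "W \<in> lmeasurable" and pos: "0 < measure lebesgue W"
  obtains G where "compact G" "G \<subseteq> W" "0 < measure lebesgue G"
proof -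
  obtain T where T: "closed T" "T \<subseteq> W" "W - T \<in> lmeasurable"
      "emeasure lebesgue (W - T) < ennreal (measure lebesgue W)"
    using sets_lebesgue_inner_closed[of W "measure lebesgue W"] W pos by (metis fmeasurableD)
  have Tn: "T \<inter> cball 0 (real n) \<in> lmeasurable" for n
    using T by (simp add: lmeasurable_compact closed_Int_compact)
  have "\<exists>n. measure lebesgue (T \<inter> cball 0 (real n)) \<noteq> 0"
  proof (rule ccontr)
    assume "\<not> ?thesis"
    then have "T \<inter> cball 0 (real n) \<in> null_sets lebesgue" for n
      using Tn[of n] by (simp add: null_sets_def emeasure_eq_measure2 fmeasurableD)
    then have "(\<Union>n. T \<inter> cball 0 (real n)) \<in> null_sets lebesgue"
      by (rule null_sets_UN)
    moreover have "(\<Union>n. T \<inter> cball 0 (real n)) = T"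
      by (auto simp: real_arch_simple)
    ultimately have "emeasure lebesgue (W - T) = emeasure lebesgue W"
      using W by (simp add: emeasure_Diff_null_set fmeasurableD)
    with T(4) W show False by (simp add: emeasure_eq_measure2)
  qed
  then obtain n where "measure lebesgue (T \<inter> cball 0 (real n)) \<noteq> 0" ..
  then show thesis
    using T by (intro that[of "T \<inter> cball 0 (real n)"])
      (auto simp: closed_Int_compact zero_less_measure_iff)
qed

text \<open>Pick a compact \<open>G\<close> of positive measure on which both \<open>z\<close> and \<open>z - (x - y)\<close> stay in \<open>\<Omega>\<close>.
  Small translations of \<open>G\<close> move little mass out of \<open>G\<close>, so the average over \<open>\<sigma> \<in> G\<close> of the mass lost
  by the shift \<open>\<sigma> - x\<close> is small, and some \<open>\<sigma>\<close> is at least as good as the average.\<close>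

lemma nearly_covered_two_balls:
  fixes \<Omega> :: "'a::euclidean_space set"
  assumes \<Omega>: "\<Omega> \<in> sets lebesgue" "emeasure lebesgue \<Omega> < \<infinity>"
    and pos: "emeasure lebesgue (\<Omega> \<inter> (\<lambda>z. z + (x - y)) ` \<Omega>) > 0"
  obtains r where "0 < r" "nearly_covered \<Omega> (ball x r \<union> ball y r)"
proof -
  define W where "W = \<Omega> \<inter> (\<lambda>z. z + (x - y)) ` \<Omega>"
  have \<Omega>L: "\<Omega> \<in> lmeasurable"
    using \<Omega> by (simp add: fmeasurable_def)
  have "(\<lambda>z. z + (x - y)) ` \<Omega> \<in> lmeasurable"
    using measurable_translation[OF \<Omega>L, of "x - y"] by (simp add: add.commute)
  then have W: "W \<in> lmeasurable"
    unfolding W_def using \<Omega>L by (simp add: fmeasurable.Int)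
  have "0 < measure lebesgue W"
    using pos W by (simp add: W_def emeasure_eq_measure2)
  then obtain G where G: "compact G" "G \<subseteq> W" "0 < measure lebesgue G"
    using compact_positive_measure_subset[OF W] by blast
  define m where "m = measure lebesgue G"
  have Gb: "G \<in> sets borel" using G by (simp add: borel_compact)
  have m: "emeasure lborel G = ennreal m" "0 < m"
    using G Gb lmeasurable_compact[OF G(1)] emeasure_completion[of G lborel]
    by (simp_all add: m_def emeasure_eq_measure2)
  have G\<Omega>: "z \<in> \<Omega>" "z - (x - y) \<in> \<Omega>" if "z \<in> G" for z
    using G(2) that by (auto simp: W_def)
  \<comment> \<open>\<open>m / 32\<close> is half of the \<open>m / 16\<close> that averaging has to
    beat, so the final comparison is strict.\<close>
  obtain r where r: "0 < r"
    "\<And>h. norm h < r \<Longrightarrow> emeasure lborel {z \<in> G. z + h \<notin> G} \<le> ennreal (m / 32)"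
    using compact_translate_small[OF G(1), of "m / 32"] m(2) by auto
  \<comment> \<open>The shift by \<open>\<sigma> - x\<close> moves \<open>T \<sigma>\<close> into
    the union of \<open>G\<close> and \<open>G\<close> translated by \<open>- (x - y)\<close>, both
    contained in \<open>\<Omega>\<close>. For most \<open>\<sigma>\<close> in \<open>G\<close>,
    points near \<open>x\<close> meet the first alternative and points near \<open>y\<close> the
    second.\<close>
  define T where "T = (\<lambda>\<sigma>. (\<lambda>w. \<sigma> + (w - x)) -` G \<union> (\<lambda>w. \<sigma> + (w - y)) -` G)"
  have T_closed: "closed (T \<sigma>)" for \<sigma>
    unfolding T_def using G(1)
    by (intro closed_Un continuous_closed_vimage) (auto simp: compact_imp_closed intro!: continuous_intros)
  have T_cov: "w + (\<sigma> - x) \<in> \<Omega>" if "w \<in> T \<sigma>" for w \<sigma>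
    using that G\<Omega>[of "\<sigma> + (w - x)"] G\<Omega>[of "\<sigma> + (w - y)"]
    by (auto simp: T_def algebra_simps)
  define E where "E = {(\<sigma>, w). w \<in> T \<sigma>}"
  have "closed E"
  proof -
    have "E = (\<lambda>p. fst p + (snd p - x)) -` G \<union> (\<lambda>p. fst p + (snd p - y)) -` G"
      by (auto simp: E_def T_def)
    then show ?thesis
      using G(1) by (auto simp: compact_imp_closed intro!: closed_Un continuous_closed_vimage continuous_intros)
  qed
  then have E: "E \<in> sets (borel \<Otimes>\<^sub>M borel)"
    by (metis borel_prod borel_closed)
  have small: "emeasure lborel {\<sigma> \<in> G. w \<notin> T \<sigma>} \<le> ennreal (m / 32)"
    if "w \<in> ball x r \<union> ball y r" for w
  proof -
    have "\<exists>c. (c = x \<or> c = y) \<and> norm (w - c) < r"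
      using that by (auto simp: dist_norm norm_minus_commute)
    then obtain c where c: "c = x \<or> c = y" "norm (w - c) < r" by blast
    have "{\<sigma> \<in> G. w \<notin> T \<sigma>} \<subseteq> {z \<in> G. z + (w - c) \<notin> G}"
      using c(1) by (auto simp: T_def)
    moreover have "{z \<in> G. z + (w - c) \<notin> G} \<in> sets borel"
    proof -
      have "{z \<in> G. z + (w - c) \<notin> G} = G \<inter> (\<lambda>z. z + (w - c)) -` (- G)" by auto
      then show ?thesis
        using Gb measurable_sets_borel[of "\<lambda>z. z + (w - c)" borel "- G"] by simp
    qed
    ultimately have "emeasure lborel {\<sigma> \<in> G. w \<notin> T \<sigma>} \<le> emeasure lborel {z \<in> G. z + (w - c) \<notin> G}"
      by (intro emeasure_mono) auto
    also have "\<dots> \<le> ennreal (m / 32)"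
      by (rule r(2)[OF c(2)])
    finally show ?thesis .
  qed
  have "nearly_covered \<Omega> (ball x r \<union> ball y r)"
    unfolding nearly_covered_def
  proof (intro allI impI)
    fix g :: "'a \<Rightarrow> real"
    assume g: "bdd_fun_on (ball x r \<union> ball y r) g" and g0: "\<forall>x. 0 \<le> g x"
    note [measurable] = bdd_fun_on_measurable[OF g] E Gb
    define I where "I = (LINT w|lborel. g w)"
    have I: "(\<integral>\<^sup>+w. g w \<partial>lborel) = ennreal I"
      unfolding I_def using g g0 by (intro nn_integral_eq_integral bdd_fun_on_integrable) auto
    have I0: "0 \<le> I" unfolding I_def using g0 by simp
    define J where "J = (\<lambda>\<sigma>. LINT w|lborel. g w * indicator (- T \<sigma>) w)"
    have Tb: "T \<sigma> \<in> sets borel" for \<sigma> using T_closed by (simp add: borel_closed)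
    have gi: "bdd_fun_on ((ball x r \<union> ball y r) \<inter> - T \<sigma>) (\<lambda>w. g w * indicator (- T \<sigma>) w)" for \<sigma>
      using g T_closed by (intro bdd_fun_on_restrict) auto
    have J: "(\<integral>\<^sup>+w. ennreal (g w) * indicator (- T \<sigma>) w \<partial>lborel) = ennreal (J \<sigma>)" for \<sigma>
    proof -
      have "(\<integral>\<^sup>+w. ennreal (g w * indicator (- T \<sigma>) w) \<partial>lborel) = ennreal (J \<sigma>)"
        unfolding J_def using gi g0 by (intro nn_integral_eq_integral bdd_fun_on_integrable) auto
      moreover have "ennreal (g w * indicator (- T \<sigma>) w) = ennreal (g w) * indicator (- T \<sigma>) w" for w
        by (simp add: indicator_def)
      ultimately show ?thesis by simp
    qed
    have "\<exists>\<sigma>\<in>G. 16 * J \<sigma> \<le> I"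
    proof (rule ccontr)
      assume neg: "\<not> ?thesis"
      have "G \<noteq> {}" using G by auto
      then obtain \<sigma>0 where "\<sigma>0 \<in> G" by blast
      \<comment> \<open>If the integral of \<open>g\<close> is 0, every \<open>\<sigma>\<close>
        works because \<open>J \<sigma> \<le> I\<close>. Positivity is what makes the last
        inequality absurd.\<close>
      have Ipos: "0 < I"
      proof (rule ccontr)
        assume "\<not> 0 < I"
        have "J \<sigma>0 \<le> I"
          unfolding J_def I_def using g0 g gi
          by (intro integral_mono bdd_fun_on_integrable) (auto simp: indicator_def)
        then show False
          using neg \<open>\<sigma>0 \<in> G\<close> \<open>\<not> 0 < I\<close> I0 by force
      qed
      have "ennreal (I / 16) * ennreal m = (\<integral>\<^sup>+\<sigma>. ennreal (I / 16) * indicator G \<sigma> \<partial>lborel)"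
        using m Gb by (simp add: nn_integral_cmult_indicator)
      also have "\<dots> \<le> (\<integral>\<^sup>+\<sigma>. (\<integral>\<^sup>+w. ennreal (g w) * indicator (- T \<sigma>) w \<partial>lborel) * indicator G \<sigma> \<partial>lborel)"
      proof (rule nn_integral_mono)
        fix \<sigma>
        show "ennreal (I / 16) * indicator G \<sigma>
          \<le> (\<integral>\<^sup>+w. ennreal (g w) * indicator (- T \<sigma>) w \<partial>lborel) * indicator G \<sigma>"
          unfolding J using neg by (force simp: indicator_def intro!: ennreal_leI)
      qed
      \<comment> \<open>Expressing the condition through the closed set \<open>E\<close> makes the
        integrand jointly measurable, as the exchange of integrals requires.\<close>
      also have "\<dots> = (\<integral>\<^sup>+\<sigma>. \<integral>\<^sup>+w. ennreal (g w) * (indicator (- E) (\<sigma>, w) * indicator G \<sigma>) \<partial>lborel \<partial>lborel)"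
        by (intro nn_integral_cong) (auto simp: indicator_def E_def intro!: nn_integral_cong)
      also have "\<dots> = (\<integral>\<^sup>+w. \<integral>\<^sup>+\<sigma>. ennreal (g w) * (indicator (- E) (\<sigma>, w) * indicator G \<sigma>) \<partial>lborel \<partial>lborel)"
        by (rule lborel_pair.Fubini') simp
      also have "\<dots> \<le> (\<integral>\<^sup>+w. ennreal (g w) * ennreal (m / 32) \<partial>lborel)"
      proof (rule nn_integral_mono)
        fix w
        show "(\<integral>\<^sup>+\<sigma>. ennreal (g w) * (indicator (- E) (\<sigma>, w) * indicator G \<sigma>) \<partial>lborel)
          \<le> ennreal (g w) * ennreal (m / 32)"
        proof (cases "w \<in> ball x r \<union> ball y r")
          case True
          have "(\<integral>\<^sup>+\<sigma>. ennreal (g w) * (indicator (- E) (\<sigma>, w) * indicator G \<sigma>) \<partial>lborel)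
            = ennreal (g w) * (\<integral>\<^sup>+\<sigma>. indicator (- E) (\<sigma>, w) * indicator G \<sigma> \<partial>lborel)"
            by (rule nn_integral_cmult) simp
          also have "(\<integral>\<^sup>+\<sigma>. indicator (- E) (\<sigma>, w) * indicator G \<sigma> \<partial>lborel)
            = (\<integral>\<^sup>+\<sigma>. indicator {\<sigma> \<in> G. w \<notin> T \<sigma>} \<sigma> \<partial>lborel)"
            by (intro nn_integral_cong) (auto simp: indicator_def E_def)
          also have "\<dots> = emeasure lborel {\<sigma> \<in> G. w \<notin> T \<sigma>}"
          proof (rule nn_integral_indicator)
            have "{\<sigma> \<in> G. w \<notin> T \<sigma>} = G - (\<lambda>\<sigma>. (\<sigma>, w)) -` E"
              by (auto simp: E_def)
            also have "\<dots> \<in> sets borel"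
              using compact_imp_closed[OF G(1)] \<open>closed E\<close>
              by (intro sets.Diff borel_closed continuous_closed_vimage) (auto intro!: continuous_intros)
            finally show "{\<sigma> \<in> G. w \<notin> T \<sigma>} \<in> sets lborel" by simp
          qed
          also have "ennreal (g w) * \<dots> \<le> ennreal (g w) * ennreal (m / 32)"
            using small[OF True] by (rule mult_left_mono) simp
          finally show ?thesis .
        next
          case False
          then show ?thesis using bdd_fun_on_eq_0[OF g] by simp
        qed
      qed
      also have "\<dots> = ennreal I * ennreal (m / 32)"
        by (simp add: nn_integral_multc I)
      finally have "I / 16 * m \<le> I * (m / 32)"
        using I0 m by (simp add: ennreal_mult[symmetric])
      then show False using Ipos m by (simp add: field_simps)
    qed
    then obtain \<sigma> where "16 * J \<sigma> \<le> I" by blast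
    then show "\<exists>T\<in>sets borel. \<exists>s. (\<forall>x\<in>T. x + s \<in> \<Omega>) \<and>
        16 * (LINT x|lborel. g x * indicator (- T) x) \<le> (LINT x|lborel. g x)"
      using Tb T_cov unfolding J_def I_def by blast
  qed
  with r(1) show thesis by (rule that)
qed

section \<open>Fourier coefficients and inner products\<close>

definition character :: "'a::euclidean_space \<Rightarrow> 'a \<Rightarrow> complex" where
  "character l x = exp (- 2 * complex_of_real pi * \<i> * complex_of_real (l \<bullet> x))"

definition ft :: "('a::euclidean_space \<Rightarrow> complex) \<Rightarrow> 'a \<Rightarrow> complex" where
  "ft u l = (LINT x|lborel. u x * character l x)"

definition ip :: "('a::euclidean_space \<Rightarrow> complex) \<Rightarrow> ('a \<Rightarrow> complex) \<Rightarrow> complex" where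
  "ip u v = (LINT x|lborel. u x * cnj (v x))"

definition nrm2 :: "('a::euclidean_space \<Rightarrow> complex) \<Rightarrow> real" where
  "nrm2 u = (LINT x|lborel. (norm (u x))\<^sup>2)"

lemma norm_character [simp]: "norm (character l x) = 1"
  by (simp add: character_def norm_exp_eq_Re)

lemma character_diff: "character l x = character l (x - t) * character l t"
  by (simp add: character_def exp_add[symmetric] inner_diff_right algebra_simps)

lemma cnj_character: "character l x * cnj (character l x) = 1"
  by (simp add: complex_norm_square[symmetric])

lemma character_measurable: "character l \<in> borel_measurable borel"
  unfolding character_def[abs_def] by (intro borel_measurable_continuous_onI continuous_intros)

lemma bdd_fun_on_character:
  assumes "bdd_fun_on S u"
  shows "bdd_fun_on S (\<lambda>x. u x * character l x)"
  by (rule bdd_fun_on_dominated[OF assms, where C = 1])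
    (auto simp: norm_mult intro!: borel_measurable_times bdd_fun_on_measurable[OF assms] character_measurable)

lemma ft_add:
  assumes "bdd_fun_on S u" "bdd_fun_on S' v"
  shows "ft (\<lambda>x. u x + v x) l = ft u l + ft v l"
  using assms[THEN bdd_fun_on_character, THEN bdd_fun_on_integrable]
  by (simp add: ft_def distrib_right)

lemma ft_scale: "ft (\<lambda>x. c * u x) l = c * ft u l"
  by (simp add: ft_def mult.assoc)

lemma ft_translate:
  assumes "bdd_fun_on S u"
  shows "ft (\<lambda>x. u (x - t)) l = character l t * ft u l"
proof -
  have "(LINT x|lborel. (u x * character l x) * character l t) = ft u l * character l t"
    unfolding ft_def by (rule integral_mult_left_zero)
  moreover have "(\<lambda>x. (u x * character l x) * character l t) \<in> borel_measurable borel"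
    using bdd_fun_on_measurable[OF bdd_fun_on_character[OF assms]] by simp
  from lborel_integral_translate[OF this, of t]
  have "ft (\<lambda>x. u (x - t)) l = (LINT x|lborel. (u x * character l x) * character l t)"
    unfolding ft_def by (simp only: mult.assoc character_diff[of l _ t, symmetric])
  ultimately show ?thesis
    by (simp add: mult.commute)
qed

lemma ip_add_left:
  assumes "bdd_fun_on S u" "bdd_fun_on S' v" "bdd_fun_on S'' w"
  shows "ip (\<lambda>x. u x + v x) w = ip u w + ip v w"
  using assms by (simp add: ip_def distrib_right bdd_fun_on_integrable_mult)

lemma ip_add_right:
  assumes "bdd_fun_on S u" "bdd_fun_on S' v" "bdd_fun_on S'' w"
  shows "ip u (\<lambda>x. v x + w x) = ip u v + ip u w"
  using assms by (simp add: ip_def distrib_left bdd_fun_on_integrable_mult)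

lemma ip_scale_left: "ip (\<lambda>x. c * u x) v = c * ip u v"
  by (simp add: ip_def mult.assoc)

lemma ip_scale_right: "ip u (\<lambda>x. c * v x) = cnj c * ip u v"
  by (simp add: ip_def mult.left_commute)

lemma ip_self: "ip u u = of_real (nrm2 u)"
  by (simp add: ip_def nrm2_def complex_norm_square[symmetric] flip: of_real_power)

lemma nrm2_nonneg: "0 \<le> nrm2 u"
  by (simp add: nrm2_def)

lemma nrm2_scale: "nrm2 (\<lambda>x. c * u x) = (norm c)\<^sup>2 * nrm2 u"
  by (simp add: nrm2_def norm_mult power_mult_distrib)

lemma nrm2_translate:
  assumes "bdd_fun_on S u"
  shows "nrm2 (\<lambda>x. u (x - t)) = nrm2 u"
  unfolding nrm2_def
  by (rule lborel_integral_translate[of "\<lambda>x. (norm (u x))\<^sup>2"])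
    (use bdd_fun_on_measurable[OF assms] in simp)

lemma nrm2_restrict_le:
  assumes u: "bdd_fun_on S u" and T: "T \<in> sets borel"
  shows "nrm2 (\<lambda>x. u x * indicator T x) \<le> nrm2 u"
  unfolding nrm2_def
proof (rule integral_mono)
  show "integrable lborel (\<lambda>x. (norm (u x * indicator T x))\<^sup>2)"
    by (rule bdd_fun_on_integrable[OF bdd_fun_on_norm_power2[OF bdd_fun_on_restrict[OF u T]]])
  show "integrable lborel (\<lambda>x. (norm (u x))\<^sup>2)"
    by (rule bdd_fun_on_integrable[OF bdd_fun_on_norm_power2[OF u]])
qed (simp add: indicator_def)

lemma nrm2_restrict:
  fixes u :: "'a::euclidean_space \<Rightarrow> complex"
  shows "nrm2 (\<lambda>x. u x * indicator T x) = (LINT x|lborel. (norm (u x))\<^sup>2 * indicator T x)"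
  unfolding nrm2_def by (rule Bochner_Integration.integral_cong) (auto simp: indicator_def)

lemma norm_mult_cnj_le: "norm (a * cnj b) \<le> ((norm a)\<^sup>2 + (norm b)\<^sup>2) / 2"
  using sum_squares_bound[of "norm a" "norm b"] by (simp add: norm_mult)

text \<open>AM-GM instead of Cauchy-Schwarz: a bound by a sum suffices, since
  \<open>D_nearly_covered\<close> later rescales \<open>u\<close> and \<open>v\<close> against each
  other.\<close>

lemma norm_ip_le:
  assumes u: "bdd_fun_on S u" and v: "bdd_fun_on S' v"
  shows "norm (ip u v) \<le> (nrm2 u + nrm2 v) / 2"
proof -
  note i = bdd_fun_on_integrable[OF bdd_fun_on_norm_power2[OF u]]
    bdd_fun_on_integrable[OF bdd_fun_on_norm_power2[OF v]]
  have "norm (ip u v) \<le> (LINT x|lborel. norm (u x * cnj (v x)))"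
    unfolding ip_def by simp
  also have "\<dots> \<le> (LINT x|lborel. ((norm (u x))\<^sup>2 + (norm (v x))\<^sup>2) / 2)"
    using u v i by (intro integral_mono norm_mult_cnj_le integrable_norm bdd_fun_on_integrable_mult) auto
  also have "\<dots> = (nrm2 u + nrm2 v) / 2"
    unfolding nrm2_def using i by simp
  finally show ?thesis .
qed

text \<open>Cauchy-Schwarz against the indicator of a ball containing \<open>S\<close>. The constant
  is uniform in \<open>u\<close> and \<open>l\<close>; it starts the recursion in
  \<open>bessel\<close>.\<close>

lemma norm_ft_power2_le:
  fixes S :: "'a::euclidean_space set"
  assumes "bounded S"
  obtains C where "\<And>u l. bdd_fun_on S u \<Longrightarrow> (norm (ft u l))\<^sup>2 \<le> C * nrm2 u"
proof -
  obtain r where "0 < r" "S \<subseteq> ball 0 r"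
    using bounded_subset_ballD[OF assms] by blast
  then have r: "0 < r" "S \<subseteq> cball 0 r" by auto
  define m where "m = measure lborel (cball (0::'a) r)"
  have m: "0 < m"
    unfolding m_def using r content_cball_pos by blast
  have "(norm (ft u l))\<^sup>2 \<le> m * nrm2 u" if u: "bdd_fun_on S u" for u l
  proof -
    define I where "I = (LINT x|lborel. norm (u x))"
    note iu = bdd_fun_on_integrable[OF u]
    note iu2 = bdd_fun_on_integrable[OF bdd_fun_on_norm_power2[OF u]]
    have ib: "integrable lborel (indicator (cball 0 r) :: 'a \<Rightarrow> real)"
      by (rule integrable_real_indicator) (simp, rule emeasure_lborel_cball_finite)
    have "norm (ft u l) \<le> (LINT x|lborel. norm (u x * character l x))"
      unfolding ft_def by simp
    also have "\<dots> = I" by (simp add: I_def norm_mult)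
    finally have "norm (ft u l) \<le> I" .
    then have le: "(norm (ft u l))\<^sup>2 \<le> I\<^sup>2" by (simp add: power_mono)
    \<comment> \<open>The mean of \<open>norm (u x)\<close> over the ball, which minimises the
      quadratic polynomial in \<open>t\<close> below.\<close>
    define t where "t = I / m"
    have "0 \<le> (LINT x|lborel. (norm (u x) - t)\<^sup>2 * indicator (cball 0 r) x)"
      by simp
    also have "\<dots> = (LINT x|lborel. (norm (u x))\<^sup>2 - 2 * t * norm (u x) + t\<^sup>2 * indicator (cball 0 r) x)"
    proof (rule Bochner_Integration.integral_cong)
      fix x
      show "(norm (u x) - t)\<^sup>2 * indicator (cball 0 r) x
        = (norm (u x))\<^sup>2 - 2 * t * norm (u x) + t\<^sup>2 * indicator (cball 0 r) x"
        using bdd_fun_on_eq_0[OF bdd_fun_on_mono[OF u r(2)], of x]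
        by (cases "x \<in> cball 0 r") (simp_all add: indicator_def power2_eq_square algebra_simps)
    qed simp
    also have "\<dots> = nrm2 u - 2 * t * I + t\<^sup>2 * m"
      using iu iu2 ib by (simp add: nrm2_def I_def m_def)
    also have "t\<^sup>2 * m = t * I" using m by (simp add: t_def power2_eq_square)
    finally have "t * I \<le> nrm2 u" by (simp add: mult.commute)
    then have "I\<^sup>2 \<le> m * nrm2 u"
      using m by (simp add: t_def field_simps power2_eq_square)
    with le show ?thesis by simp
  qed
  then show thesis by (rule that)
qed

text \<open>Compactness as a local-to-global principle. Unions are asked only of open sets, so that
  in applications a function can be cut with the Borel indicator of one of them.\<close>

lemma compact_additive_property:
  fixes X :: "'a::metric_space set"
  assumes "compact X" and P0: "P {}"
    and mono: "\<And>A B. P B \<Longrightarrow> A \<subseteq> B \<Longrightarrow> P A"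
    and un: "\<And>A B. open A \<Longrightarrow> open B \<Longrightarrow> P A \<Longrightarrow> P B \<Longrightarrow> P (A \<union> B)"
    and loc: "\<And>x. x \<in> X \<Longrightarrow> \<exists>r>0. P (ball x r)"
  shows "P X"
proof -
  obtain r where r: "\<And>x. x \<in> X \<Longrightarrow> 0 < r x \<and> P (ball x (r x))"
    using loc by metis
  obtain D where D: "D \<subseteq> X" "finite D" "X \<subseteq> (\<Union>x\<in>D. ball x (r x))"
    using compactE_image[OF \<open>compact X\<close>, of X "\<lambda>x. ball x (r x)"] r by force
  have "P (\<Union>x\<in>D. ball x (r x))"
    using D(2,1)
  proof (induction D)
    case (insert x F)
    then show ?case using r by (auto intro!: un)
  qed (simp add: P0)
  with D(3) show ?thesis by (rule mono[rotated])
qed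

section \<open>Orthogonality of distant functions\<close>

text \<open>The overlap hypothesis enters only through its consequence \<open>covered\<close>, and
  the frame identity only for bounded Borel functions. The assumptions are contradictory, which is
  what \<open>no_tight_frame\<close> shows.\<close>

locale tight_frame =
  fixes \<Omega> \<Lambda> :: "'a::euclidean_space set" and A R :: real
  assumes A_pos: "0 < A" and R_nonneg: "0 \<le> R"
    and frame: "\<And>u. bdd_fun_on \<Omega> u \<Longrightarrow> ((\<lambda>l. (norm (ft u l))\<^sup>2) has_sum A * nrm2 u) \<Lambda>"
    and covered: "\<And>x y. R < dist x y \<Longrightarrow> \<exists>r>0. nearly_covered \<Omega> (ball x r \<union> ball y r)"
begin

section \<open>Bessel bound and square summability of the coefficients\<close>

lemma frame_translate:
  assumes u: "bdd_fun_on T u" and T: "\<And>x. x \<in> T \<Longrightarrow> x + s \<in> \<Omega>"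
  shows "((\<lambda>l. (norm (ft u l))\<^sup>2) has_sum A * nrm2 u) \<Lambda>"
proof -
  have "bdd_fun_on \<Omega> (\<lambda>x. u (x - s))"
    by (rule bdd_fun_on_mono[OF bdd_fun_on_translate[OF u]]) (use T in auto)
  from frame[OF this] show ?thesis
    by (simp add: ft_translate[OF u] nrm2_translate[OF u] norm_mult)
qed

text \<open>Any bound \<open>M\<close> for the partial sums over \<open>F\<close> improves to \<open>2 * A + M / 2\<close>: split \<open>u\<close> into a part
  supported in a translate of \<open>\<Omega>\<close> and a small rest. The fixed point is \<open>4 * A\<close>.\<close>

lemma bessel:
  assumes S: "nearly_covered \<Omega> S" "bounded S" and u: "bdd_fun_on S u"
    and F: "finite F" "F \<subseteq> \<Lambda>"
  shows "(\<Sum>l\<in>F. (norm (ft u l))\<^sup>2) \<le> 4 * A * nrm2 u"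
proof -
  obtain C where C: "\<And>u l. bdd_fun_on S u \<Longrightarrow> (norm (ft u l))\<^sup>2 \<le> C * nrm2 u"
    using norm_ft_power2_le[OF S(2)] by blast
  \<comment> \<open>Depends on \<open>F\<close> and \<open>S\<close> but not on \<open>u\<close>, so
    the induction hypothesis can be applied to the small rest \<open>b\<close>. It disappears in the
    limit.\<close>
  define M where "M = real (card F) * \<bar>C\<bar>"
  have "(\<Sum>l\<in>F. (norm (ft u l))\<^sup>2) \<le> (4 * A + M / 2 ^ n) * nrm2 u"
    if u: "bdd_fun_on S u" for u n
    using u
  proof (induction n arbitrary: u)
    case 0
    have "(\<Sum>l\<in>F. (norm (ft u l))\<^sup>2) \<le> (\<Sum>l\<in>F. \<bar>C\<bar> * nrm2 u)"
    proof (rule sum_mono)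
      fix l
      have "(norm (ft u l))\<^sup>2 \<le> C * nrm2 u" by (rule C[OF 0])
      also have "\<dots> \<le> \<bar>C\<bar> * nrm2 u"
        using nrm2_nonneg by (intro mult_right_mono) auto
      finally show "(norm (ft u l))\<^sup>2 \<le> \<bar>C\<bar> * nrm2 u" .
    qed
    also have "\<dots> \<le> (4 * A + M) * nrm2 u"
      using A_pos nrm2_nonneg[of u] by (simp add: M_def distrib_right)
    finally show ?case by simp
  next
    case (Suc n)
    obtain T s where T: "T \<in> sets borel" "\<And>x. x \<in> T \<Longrightarrow> x + s \<in> \<Omega>"
      and le: "16 * (LINT x|lborel. (norm (u x))\<^sup>2 * indicator (- T) x) \<le> nrm2 u"
      using S(1)[unfolded nearly_covered_def, rule_format, OF bdd_fun_on_norm_power2[OF Suc.prems]]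
      by (auto simp: nrm2_def)
    define a where "a = (\<lambda>x. u x * indicator T x)"
    define b where "b = (\<lambda>x. u x * indicator (- T) x)"
    have a: "bdd_fun_on (S \<inter> T) a" and b: "bdd_fun_on (S \<inter> - T) b"
      unfolding a_def b_def using T(1) by (intro bdd_fun_on_restrict Suc.prems; simp)+
    have bS: "bdd_fun_on S b" using b by (rule bdd_fun_on_mono) auto
    have ab: "ft u l = ft a l + ft b l" for l
    proof -
      have "u = (\<lambda>x. a x + b x)" by (auto simp: a_def b_def indicator_def)
      then show ?thesis using ft_add[OF a b] by simp
    qed
    have na: "nrm2 a \<le> nrm2 u" unfolding a_def using Suc.prems T(1) by (rule nrm2_restrict_le)
    have nb: "16 * nrm2 b \<le> nrm2 u" using le by (simp add: b_def nrm2_restrict)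
    have hs: "((\<lambda>l. (norm (ft a l))\<^sup>2) has_sum A * nrm2 a) \<Lambda>"
      using T(2) by (intro frame_translate[OF a]) auto
    have sa: "(\<Sum>l\<in>F. (norm (ft a l))\<^sup>2) \<le> A * nrm2 a"
      using F by (intro finite_sum_le_has_sum[OF hs]) auto
    have M0: "0 \<le> M" by (simp add: M_def)
    have "(norm (ft u l))\<^sup>2 \<le> 2 * (norm (ft a l))\<^sup>2 + 2 * (norm (ft b l))\<^sup>2" for l
    proof -
      have "(norm (ft u l))\<^sup>2 \<le> (norm (ft a l) + norm (ft b l))\<^sup>2"
        unfolding ab by (simp add: norm_triangle_ineq power_mono)
      also have "\<dots> \<le> 2 * (norm (ft a l))\<^sup>2 + 2 * (norm (ft b l))\<^sup>2"
        using sum_squares_bound[of "norm (ft a l)" "norm (ft b l)"] by (simp add: power2_sum)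
      finally show ?thesis .
    qed
    then have "(\<Sum>l\<in>F. (norm (ft u l))\<^sup>2)
        \<le> (\<Sum>l\<in>F. 2 * (norm (ft a l))\<^sup>2 + 2 * (norm (ft b l))\<^sup>2)"
      by (rule sum_mono)
    also have "\<dots> = 2 * (\<Sum>l\<in>F. (norm (ft a l))\<^sup>2) + 2 * (\<Sum>l\<in>F. (norm (ft b l))\<^sup>2)"
      by (simp add: sum.distrib sum_distrib_left)
    also have "\<dots> \<le> 2 * (A * nrm2 a) + 2 * ((4 * A + M / 2 ^ n) * nrm2 b)"
      using sa Suc.IH[OF bS] by simp
    \<comment> \<open>With \<open>nrm2 b \<le> nrm2 u / 4\<close> the constants add up to
      \<open>2 * A + (4 * A + M / 2 ^ n) / 2\<close>.\<close>
    also have "\<dots> \<le> 2 * (A * nrm2 u) + 2 * ((4 * A + M / 2 ^ n) * (nrm2 u / 4))"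
      using na nb nrm2_nonneg[of u] A_pos M0
      by (intro add_mono mult_left_mono) auto
    also have "\<dots> = (4 * A + M / 2 ^ Suc n) * nrm2 u"
      by (simp add: algebra_simps)
    finally show ?case .
  qed
  moreover have "(\<lambda>n. (4 * A + M / 2 ^ n) * nrm2 u) \<longlonglongrightarrow> (4 * A + 0) * nrm2 u"
    by (intro tendsto_intros LIMSEQ_divide_realpow_zero) auto
  ultimately show ?thesis
    using u by (intro LIMSEQ_le_const[where X = "\<lambda>n. (4 * A + M / 2 ^ n) * nrm2 u"]) auto
qed

lemma summable_nearly_covered:
  assumes S: "nearly_covered \<Omega> S" "bounded S" and u: "bdd_fun_on S u"
  shows "(\<lambda>l. (norm (ft u l))\<^sup>2) summable_on \<Lambda>"
  by (rule nonneg_bdd_above_summable_on)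
    (use bessel[OF S u] in \<open>auto intro!: bdd_aboveI[of _ "4 * A * nrm2 u"]\<close>)

text \<open>Summability holds on small balls by \<open>bessel\<close>, and is inherited by sums of
  two functions. Compactness extends it to any bounded support, without a uniform constant.\<close>

lemma summable:
  assumes u: "bdd_fun_on S u"
  shows "(\<lambda>l. (norm (ft u l))\<^sup>2) summable_on \<Lambda>"
proof -
  define P where "P = (\<lambda>S. \<forall>u. bdd_fun_on S u \<longrightarrow> (\<lambda>l. (norm (ft u l))\<^sup>2) summable_on \<Lambda>)"
  obtain K where K: "{x. u x \<noteq> 0} \<subseteq> cball 0 K"
    using u bounded_subset_cball[of "{x. u x \<noteq> 0}"] bounded_any_center[of _ "0::'a"]
    unfolding bdd_fun_on_def by (metis mem_cball subsetI)
  have "P (cball 0 K)"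
  proof (rule compact_additive_property)
    have "ft u l = 0" if "bdd_fun_on {} u" for u :: "'a \<Rightarrow> complex" and l
      using bdd_fun_on_eq_0[OF that] by (simp add: ft_def)
    then show "P {}" by (simp add: P_def)
    show "P X" if "P Y" "X \<subseteq> Y" for X Y
      using that bdd_fun_on_mono unfolding P_def by blast
    show "P (X \<union> Y)" if XY: "open X" "P X" "P Y" for X Y
      unfolding P_def
    proof (intro allI impI)
      fix u :: "'a \<Rightarrow> complex" assume u: "bdd_fun_on (X \<union> Y) u"
      define a where "a = (\<lambda>x. u x * indicator X x)"
      define b where "b = (\<lambda>x. u x * indicator (- X) x)"
      have a: "bdd_fun_on ((X \<union> Y) \<inter> X) a" and b: "bdd_fun_on ((X \<union> Y) \<inter> - X) b"
        unfolding a_def b_def using XY(1) by (intro bdd_fun_on_restrict u; simp)+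
      have ab: "ft u l = ft a l + ft b l" for l
      proof -
        have "u = (\<lambda>x. a x + b x)" by (auto simp: a_def b_def indicator_def)
        then show ?thesis using ft_add[OF a b] by simp
      qed
      have sm: "(\<lambda>l. 2 * (norm (ft a l))\<^sup>2 + 2 * (norm (ft b l))\<^sup>2) summable_on \<Lambda>"
        using XY(2,3) bdd_fun_on_mono[OF a] bdd_fun_on_mono[OF b]
        by (intro summable_on_add summable_on_cmult_right) (auto simp: P_def)
      have "norm ((norm (ft u l))\<^sup>2) \<le> 2 * (norm (ft a l))\<^sup>2 + 2 * (norm (ft b l))\<^sup>2" for l
      proof -
        have "(norm (ft u l))\<^sup>2 \<le> (norm (ft a l) + norm (ft b l))\<^sup>2"
          unfolding ab by (simp add: norm_triangle_ineq power_mono)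
        also have "\<dots> \<le> 2 * (norm (ft a l))\<^sup>2 + 2 * (norm (ft b l))\<^sup>2"
          using sum_squares_bound[of "norm (ft a l)" "norm (ft b l)"] by (simp add: power2_sum)
        finally show ?thesis by simp
      qed
      from Infinite_Sum.abs_summable_on_comparison_test'[OF sm this]
      show "(\<lambda>l. (norm (ft u l))\<^sup>2) summable_on \<Lambda>" by simp
    qed
    show "\<exists>r>0. P (ball x r)" for x
    proof -
      \<comment> \<open>\<open>covered\<close> speaks of pairs of distant balls only; any point at
        distance more than \<open>R\<close> serves as a partner, and its ball is then
        dropped.\<close>
      obtain b :: 'a where "norm b = \<bar>R\<bar> + 1"
        by (rule vector_choose_size[of "\<bar>R\<bar> + 1"]) auto
      then have "R < dist x (x + b)" by (simp add: dist_norm)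
      from covered[OF this] obtain r where "0 < r" "nearly_covered \<Omega> (ball x r)"
        by (meson nearly_covered_mono sup_ge1)
      then show ?thesis
        unfolding P_def using summable_nearly_covered bounded_ball by blast
    qed
  qed simp
  moreover have "bdd_fun_on (cball 0 K) u"
    using u K by (simp add: bdd_fun_on_def)
  ultimately show ?thesis by (simp add: P_def)
qed

section \<open>The sesquilinear forms of coefficients and functions, and their difference\<close>

definition Q :: "('a \<Rightarrow> complex) \<Rightarrow> ('a \<Rightarrow> complex) \<Rightarrow> complex" where
  "Q u v = (\<Sum>\<^sub>\<infinity>l\<in>\<Lambda>. ft u l * cnj (ft v l))"

text \<open>The defect in the polarized frame identity. For functions with disjoint supports it
  equals \<open>Q\<close>, so its vanishing then means orthogonality of the coefficient
  sequences.\<close>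

definition D :: "('a \<Rightarrow> complex) \<Rightarrow> ('a \<Rightarrow> complex) \<Rightarrow> complex" where
  "D u v = Q u v - of_real A * ip u v"

lemma summable_mult:
  assumes "bdd_fun_on S u" "bdd_fun_on S' v"
  shows "(\<lambda>l. norm (ft u l * cnj (ft v l))) summable_on \<Lambda>" (is ?g1)
    and "(\<lambda>l. ft u l * cnj (ft v l)) summable_on \<Lambda>" (is ?g2)
proof -
  have "(\<lambda>l. (1/2) * ((norm (ft u l))\<^sup>2 + (norm (ft v l))\<^sup>2)) summable_on \<Lambda>"
    using assms by (intro summable_on_cmult_right summable_on_add summable)
  then show ?g1
    by (rule Infinite_Sum.abs_summable_on_comparison_test') (use norm_mult_cnj_le in simp)
  then show ?g2 by (rule abs_summable_summable)
qed

lemma Q_add_left: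
  assumes "bdd_fun_on S u" "bdd_fun_on S' v" "bdd_fun_on S'' w"
  shows "Q (\<lambda>x. u x + v x) w = Q u w + Q v w"
  using assms unfolding Q_def
  by (simp add: ft_add[OF assms(1,2)] distrib_right infsum_add summable_mult)

lemma Q_add_right:
  assumes "bdd_fun_on S u" "bdd_fun_on S' v" "bdd_fun_on S'' w"
  shows "Q u (\<lambda>x. v x + w x) = Q u v + Q u w"
  using assms unfolding Q_def
  by (simp add: ft_add[OF assms(2,3)] distrib_left infsum_add summable_mult)

text \<open>No summability is required: a nonzero factor does not affect it, and both sums are 0 by
  default if it fails.\<close>

lemma Q_scale_left: "Q (\<lambda>x. c * u x) v = c * Q u v"
  by (simp add: Q_def ft_scale mult.assoc infsum_cmult_right')

lemma Q_scale_right: "Q u (\<lambda>x. c * v x) = cnj c * Q u v"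
  by (simp add: Q_def ft_scale mult.left_commute infsum_cmult_right')

lemma Q_cnj: "Q v u = cnj (Q u v)"
  unfolding Q_def infsum_cnj[symmetric] by (simp add: mult.commute)

lemma Q_self:
  assumes "bdd_fun_on S u"
  shows "Q u u = of_real (\<Sum>\<^sub>\<infinity>l\<in>\<Lambda>. (norm (ft u l))\<^sup>2)"
proof -
  have "((\<lambda>l. complex_of_real ((norm (ft u l))\<^sup>2)) has_sum
      of_real (\<Sum>\<^sub>\<infinity>l\<in>\<Lambda>. (norm (ft u l))\<^sup>2)) \<Lambda>"
    by (intro has_sum_of_real has_sum_infsum summable[OF assms])
  then show ?thesis
    unfolding Q_def by (intro infsumI) (simp add: complex_norm_square[symmetric])
qed

text \<open>Pythagoras for \<open>Q\<close>; the other cross term vanishes by Hermitian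
  symmetry.\<close>

lemma infsum_ft_add_orthogonal:
  assumes u: "bdd_fun_on S u" and v: "bdd_fun_on S' v" and "Q u v = 0"
  shows "(\<Sum>\<^sub>\<infinity>l\<in>\<Lambda>. (norm (ft (\<lambda>x. u x + v x) l))\<^sup>2)
    = (\<Sum>\<^sub>\<infinity>l\<in>\<Lambda>. (norm (ft u l))\<^sup>2) + (\<Sum>\<^sub>\<infinity>l\<in>\<Lambda>. (norm (ft v l))\<^sup>2)"
proof -
  have uv: "bdd_fun_on UNIV (\<lambda>x. u x + v x)"
    by (rule bdd_fun_on_add[OF bdd_fun_on_mono[OF u subset_UNIV] bdd_fun_on_mono[OF v subset_UNIV]])
  have "Q v u = 0"
    unfolding Q_cnj[of v u] \<open>Q u v = 0\<close> by simp
  then have "Q (\<lambda>x. u x + v x) (\<lambda>x. u x + v x) = Q u u + Q v v"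
    using \<open>Q u v = 0\<close>
    by (simp add: Q_add_left[OF u v uv] Q_add_right[OF u u v] Q_add_right[OF v u v])
  then show ?thesis
    unfolding Q_self[OF u] Q_self[OF v] Q_self[OF uv] of_real_add[symmetric] of_real_eq_iff .
qed

lemma norm_Q_le:
  assumes "bdd_fun_on S u" "bdd_fun_on S' v"
  shows "norm (Q u v) \<le> ((\<Sum>\<^sub>\<infinity>l\<in>\<Lambda>. (norm (ft u l))\<^sup>2) + (\<Sum>\<^sub>\<infinity>l\<in>\<Lambda>. (norm (ft v l))\<^sup>2)) / 2"
proof -
  have "norm (Q u v) \<le> (\<Sum>\<^sub>\<infinity>l\<in>\<Lambda>. norm (ft u l * cnj (ft v l)))"
    unfolding Q_def by (rule norm_infsum_bound[OF summable_mult(1)[OF assms]])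
  also have "\<dots> \<le> (\<Sum>\<^sub>\<infinity>l\<in>\<Lambda>. (1/2) * ((norm (ft u l))\<^sup>2 + (norm (ft v l))\<^sup>2))"
    using assms norm_mult_cnj_le
    by (intro infsum_mono summable_mult summable_on_cmult_right summable_on_add summable) auto
  also have "\<dots> = ((\<Sum>\<^sub>\<infinity>l\<in>\<Lambda>. (norm (ft u l))\<^sup>2) + (\<Sum>\<^sub>\<infinity>l\<in>\<Lambda>. (norm (ft v l))\<^sup>2)) / 2"
    unfolding infsum_cmult_right' using assms by (simp add: infsum_add summable)
  finally show ?thesis .
qed

lemma D_add_left:
  assumes "bdd_fun_on S u" "bdd_fun_on S' v" "bdd_fun_on S'' w"
  shows "D (\<lambda>x. u x + v x) w = D u w + D v w"
  unfolding D_def by (simp add: Q_add_left[OF assms] ip_add_left[OF assms] algebra_simps)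

lemma D_add_right:
  assumes "bdd_fun_on S u" "bdd_fun_on S' v" "bdd_fun_on S'' w"
  shows "D u (\<lambda>x. v x + w x) = D u v + D u w"
  unfolding D_def by (simp add: Q_add_right[OF assms] ip_add_right[OF assms] algebra_simps)

lemma D_scale_left: "D (\<lambda>x. c * u x) v = c * D u v"
  by (simp add: D_def Q_scale_left ip_scale_left algebra_simps)

lemma D_scale_right: "D u (\<lambda>x. c * v x) = cnj c * D u v"
  by (simp add: D_def Q_scale_right ip_scale_right algebra_simps)

lemma D_translate_self:
  assumes u: "bdd_fun_on T u" and T: "\<And>x. x \<in> T \<Longrightarrow> x + s \<in> \<Omega>"
  shows "D u u = 0"
  using infsumI[OF frame_translate[OF assms]] by (simp add: D_def Q_self[OF u] ip_self)

text \<open>Polarization: the diagonal of \<open>D\<close> vanishes for all functions on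
  \<open>T\<close>. Testing \<open>u + v\<close> gives antisymmetry, testing
  \<open>u + \<i> v\<close> gives symmetry, and together they force 0.\<close>

lemma D_translate:
  assumes u: "bdd_fun_on T u" and v: "bdd_fun_on T v" and T: "\<And>x. x \<in> T \<Longrightarrow> x + s \<in> \<Omega>"
  shows "D u v = 0"
proof -
  have polar: "D u w + D w u = 0" if w: "bdd_fun_on T w" for w
  proof -
    have uw: "bdd_fun_on T (\<lambda>x. u x + w x)"
      using u w by (rule bdd_fun_on_add)
    have "D (\<lambda>x. u x + w x) (\<lambda>x. u x + w x) = D u u + D u w + D w u + D w w"
      by (simp add: D_add_left[OF u w uw] D_add_right[OF u u w] D_add_right[OF w u w])
    then show ?thesis
      using D_translate_self[OF u T] D_translate_self[OF w T] D_translate_self[OF uw T] by simp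
  qed
  have "D u v + D v u = 0" by (rule polar[OF v])
  moreover have "- \<i> * D u v + \<i> * D v u = 0"
    using polar[OF bdd_fun_on_scale[OF v, of \<i>]] by (simp add: D_scale_left D_scale_right)
  then have "\<i> * (D v u - D u v) = 0" by (simp add: algebra_simps)
  ultimately show ?thesis by simp
qed

text \<open>Any constant \<open>N\<close> with \<open>norm (D u v) \<le> N * (nrm2 u + nrm2 v)\<close> can be halved: \<open>D\<close> vanishes on the
  parts of \<open>u\<close> and \<open>v\<close> supported in a common translate of \<open>\<Omega>\<close>, and scaling by \<open>2\<close> and \<open>1/2\<close> balances
  the remaining small parts against the large ones.\<close>

lemma D_nearly_covered:
  assumes S: "nearly_covered \<Omega> S" "bounded S" and u: "bdd_fun_on S u" and v: "bdd_fun_on S v"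
  shows "D u v = 0"
proof -
  \<comment> \<open>\<open>bessel\<close> contributes \<open>2 * A\<close> through
    \<open>norm_Q_le\<close>, the inner product another \<open>A / 2\<close>; 3 is a round upper
    bound.\<close>
  define N where "N = 3 * A"
  have N0: "0 \<le> N" using A_pos by (simp add: N_def)
  have bound: "norm (D u v) \<le> N / 2 ^ n * (nrm2 u + nrm2 v)"
    if u: "bdd_fun_on S u" and v: "bdd_fun_on S v" for u v n
    using u v
  proof (induction n arbitrary: u v)
    case 0
    have q: "(\<Sum>\<^sub>\<infinity>l\<in>\<Lambda>. (norm (ft w l))\<^sup>2) \<le> 4 * A * nrm2 w" if w: "bdd_fun_on S w" for w
      using summable[OF w] bessel[OF S w] by (intro infsum_le_finite_sums) auto
    have "norm (D u v) \<le> norm (Q u v) + A * norm (ip u v)"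
      unfolding D_def using norm_triangle_ineq4[of "Q u v" "of_real A * ip u v"] A_pos
      by (simp add: norm_mult)
    also have "\<dots> \<le> (4 * A * nrm2 u + 4 * A * nrm2 v) / 2 + A * ((nrm2 u + nrm2 v) / 2)"
      using norm_Q_le[OF 0] q[OF 0(1)] q[OF 0(2)] norm_ip_le[OF 0] A_pos
      by (intro add_mono mult_left_mono) auto
    also have "\<dots> \<le> 3 * A * (nrm2 u + nrm2 v)"
    proof -
      have "0 \<le> A * (nrm2 u + nrm2 v)"
        using A_pos nrm2_nonneg[of u] nrm2_nonneg[of v] by simp
      then show ?thesis by (simp add: field_simps)
    qed
    finally show ?case by (simp add: N_def)
  next
    case (Suc n)
    note u = Suc.prems(1) and v = Suc.prems(2)
    \<comment> \<open>Using the sum of both densities yields one shift \<open>s\<close> that is good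
      for \<open>u\<close> and \<open>v\<close> simultaneously.\<close>
    let ?g = "\<lambda>x. (norm (u x))\<^sup>2 + (norm (v x))\<^sup>2"
    have g: "bdd_fun_on S ?g"
      by (intro bdd_fun_on_add bdd_fun_on_norm_power2 u v)
    note iu = bdd_fun_on_integrable[OF bdd_fun_on_norm_power2[OF u]]
      and iv = bdd_fun_on_integrable[OF bdd_fun_on_norm_power2[OF v]]
    obtain T s where T: "T \<in> sets borel" "\<And>x. x \<in> T \<Longrightarrow> x + s \<in> \<Omega>"
      and le: "16 * (LINT x|lborel. ?g x * indicator (- T) x) \<le> (LINT x|lborel. ?g x)"
      using S(1)[unfolded nearly_covered_def, rule_format, OF g] by auto
    define a where "a = (\<lambda>w x. w x * indicator T x :: complex)"
    define b where "b = (\<lambda>w x. w x * indicator (- T) x :: complex)"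
    have a: "bdd_fun_on (S \<inter> T) (a w)" and b: "bdd_fun_on (S \<inter> - T) (b w)"
      if "bdd_fun_on S w" for w
      unfolding a_def b_def using T(1) that by (intro bdd_fun_on_restrict; simp)+
    have aS: "bdd_fun_on S (a w)" and bS: "bdd_fun_on S (b w)" if "bdd_fun_on S w" for w
      using a[OF that] b[OF that] by (auto elim: bdd_fun_on_mono)
    have ab: "(\<lambda>x. a w x + b w x) = w" for w
      by (auto simp: a_def b_def indicator_def)
    have nb: "16 * (nrm2 (b u) + nrm2 (b v)) \<le> nrm2 u + nrm2 v"
    proof -
      have "nrm2 (b u) + nrm2 (b v) = (LINT x|lborel. ?g x * indicator (- T) x)"
        unfolding b_def nrm2_restrict distrib_right
        using bdd_fun_on_restrict[OF bdd_fun_on_norm_power2[OF u], of "- T"]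
          bdd_fun_on_restrict[OF bdd_fun_on_norm_power2[OF v], of "- T"] T(1)
        by (intro Bochner_Integration.integral_add[symmetric] bdd_fun_on_integrable) auto
      moreover have "nrm2 u + nrm2 v = (LINT x|lborel. ?g x)"
        unfolding nrm2_def using iu iv by simp
      ultimately show ?thesis using le by simp
    qed
    have na: "nrm2 (a u) \<le> nrm2 u" unfolding a_def using u T(1) by (rule nrm2_restrict_le)
    \<comment> \<open>The factors 2 and 1/2 cancel in \<open>D\<close> but weight the two energies
      by 4 and 1/4; the heavy weight is meant for the small part.\<close>
    have half: "norm (D f g) \<le> N / 2 ^ n * (4 * nrm2 f + nrm2 g / 4)"
      if f: "bdd_fun_on S f" and g: "bdd_fun_on S g" for f g
    proof -
      have "D (\<lambda>x. 2 * f x) (\<lambda>x. (1/2) * g x) = D f g"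
        by (simp only: D_scale_left D_scale_right) simp
      then show ?thesis
        using Suc.IH[OF bdd_fun_on_scale[OF f, of 2] bdd_fun_on_scale[OF g, of "1/2"]]
        by (simp only: nrm2_scale) (simp add: power2_eq_square norm_divide)
    qed
    have half': "norm (D f g) \<le> N / 2 ^ n * (nrm2 f / 4 + 4 * nrm2 g)"
      if f: "bdd_fun_on S f" and g: "bdd_fun_on S g" for f g
    proof -
      have "D (\<lambda>x. (1/2) * f x) (\<lambda>x. 2 * g x) = D f g"
        by (simp only: D_scale_left D_scale_right) simp
      then show ?thesis
        using Suc.IH[OF bdd_fun_on_scale[OF f, of "1/2"] bdd_fun_on_scale[OF g, of 2]]
        by (simp only: nrm2_scale) (simp add: power2_eq_square norm_divide)
    qed
    have "D u v = D (a u) v + D (b u) v"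
      using D_add_left[OF a[OF u] b[OF u] v] by (simp add: ab)
    also have "D (a u) v = D (a u) (a v) + D (a u) (b v)"
      using D_add_right[OF a[OF u] a[OF v] b[OF v]] by (simp add: ab)
    also have "D (a u) (a v) = 0"
      using T(2) by (intro D_translate[OF a[OF u] a[OF v]]) auto
    finally have "norm (D u v) \<le> norm (D (a u) (b v)) + norm (D (b u) v)"
      by (simp add: norm_triangle_ineq)
    also have "\<dots> \<le> N / 2 ^ n * (nrm2 (a u) / 4 + 4 * nrm2 (b v)) + N / 2 ^ n * (4 * nrm2 (b u) + nrm2 v / 4)"
      by (intro add_mono half half' aS bS u v)
    also have "\<dots> = N / 2 ^ n * (nrm2 (a u) / 4 + 4 * nrm2 (b v) + 4 * nrm2 (b u) + nrm2 v / 4)"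
      by (simp only: distrib_left add.assoc)
    \<comment> \<open>By \<open>nb\<close> the small parts, even with weight 4, cost at most a
      quarter of \<open>nrm2 u + nrm2 v\<close>; the large parts cost another quarter.\<close>
    also have "\<dots> \<le> N / 2 ^ n * ((nrm2 u + nrm2 v) / 2)"
      using N0 na nb by (intro mult_left_mono) (auto simp: field_simps)
    finally show ?case by simp
  qed
  have "(\<lambda>n. N / 2 ^ n * (nrm2 u + nrm2 v)) \<longlonglongrightarrow> 0 * (nrm2 u + nrm2 v)"
    by (intro tendsto_intros LIMSEQ_divide_realpow_zero) auto
  then have "norm (D u v) \<le> 0 * (nrm2 u + nrm2 v)"
    using bound[OF u v] by (intro LIMSEQ_le_const) auto
  then show ?thesis by simp
qed

text \<open>Two applications of compactness to the local statement \<open>D_nearly_covered\<close>: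
  first over \<open>X\<close> with a point of \<open>Y\<close> fixed, then over
  \<open>Y\<close>.\<close>

lemma D_compact:
  assumes X: "compact X" and Y: "compact Y"
    and far: "\<And>x y. x \<in> X \<Longrightarrow> y \<in> Y \<Longrightarrow> R < dist x y"
    and u: "bdd_fun_on X u" and v: "bdd_fun_on Y v"
  shows "D u v = 0"
proof -
  define Z where "Z = (\<lambda>X Y. \<forall>u v. bdd_fun_on X u \<longrightarrow> bdd_fun_on Y v \<longrightarrow> D u v = 0)"
  have split: "\<exists>a b. bdd_fun_on A a \<and> bdd_fun_on B b \<and> w = (\<lambda>x. a x + b x)"
    if "bdd_fun_on (A \<union> B) w" "open A" for A B and w :: "'a \<Rightarrow> complex"
  proof (intro exI conjI)
    show "bdd_fun_on A (\<lambda>x. w x * indicator A x)"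
      by (rule bdd_fun_on_mono[OF bdd_fun_on_restrict[OF that(1)]]) (use that in auto)
    show "bdd_fun_on B (\<lambda>x. w x * indicator (- A) x)"
      by (rule bdd_fun_on_mono[OF bdd_fun_on_restrict[OF that(1)]]) (use that in auto)
  qed (auto simp: indicator_def)
  have Z0: "D u v = 0" if "bdd_fun_on {} u \<or> bdd_fun_on {} v" for u v
    using that by (auto simp: D_def Q_def ip_def ft_def bdd_fun_on_eq_0)
  have mono: "Z A B" if "Z A' B'" "A \<subseteq> A'" "B \<subseteq> B'" for A B A' B'
    using that bdd_fun_on_mono unfolding Z_def by blast
  have un_left: "Z (A \<union> A') B" if "open A" "Z A B" "Z A' B" for A A' B
    unfolding Z_def
  proof (intro allI impI)
    fix u v :: "'a \<Rightarrow> complex"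
    assume u: "bdd_fun_on (A \<union> A') u" and v: "bdd_fun_on B v"
    from split[OF u \<open>open A\<close>] obtain a b
      where ab: "bdd_fun_on A a" "bdd_fun_on A' b" "u = (\<lambda>x. a x + b x)" by blast
    with that v show "D u v = 0"
      by (simp add: D_add_left[OF ab(1,2) v] Z_def)
  qed
  have un_right: "Z A (B \<union> B')" if "open B" "Z A B" "Z A B'" for A B B'
    unfolding Z_def
  proof (intro allI impI)
    fix u v :: "'a \<Rightarrow> complex"
    assume u: "bdd_fun_on A u" and v: "bdd_fun_on (B \<union> B') v"
    from split[OF v \<open>open B\<close>] obtain a b
      where ab: "bdd_fun_on B a" "bdd_fun_on B' b" "v = (\<lambda>x. a x + b x)" by blast
    with that u show "D u v = 0"
      by (simp add: D_add_right[OF u ab(1,2)] Z_def)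
  qed
  have loc: "\<exists>r>0. Z (ball x r) (ball y r)" if xy: "x \<in> X" "y \<in> Y" for x y
  proof -
    obtain r where r: "0 < r" "nearly_covered \<Omega> (ball x r \<union> ball y r)"
      using covered[OF far[OF xy]] by blast
    then show ?thesis
      unfolding Z_def using D_nearly_covered[OF r(2)]
      by (metis bdd_fun_on_mono bounded_Un bounded_ball sup_ge1 sup_ge2)
  qed
  \<comment> \<open>The radius around \<open>y\<close> may depend on the piece of \<open>X\<close>.
    A union takes the smaller of two radii, so it stays positive after finitely many steps.\<close>
  have "\<exists>r>0. Z X (ball y r)" if y: "y \<in> Y" for y
    using X
  proof (rule compact_additive_property[where P = "\<lambda>X. \<exists>r>0. Z X (ball y r)"])
    show "\<exists>r>0. Z {} (ball y r)"
      using Z0 by (auto simp: Z_def intro!: exI[of _ 1])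
    show "\<exists>r>0. Z A (ball y r)" if "\<exists>r>0. Z B (ball y r)" "A \<subseteq> B" for A B
      using that mono by blast
    show "\<exists>r>0. Z (A \<union> B) (ball y r)"
      if "open A" "\<exists>r>0. Z A (ball y r)" "\<exists>r>0. Z B (ball y r)" for A B
    proof -
      from that obtain r s where "0 < r" "0 < s" "Z A (ball y r)" "Z B (ball y s)"
        by blast
      then have "0 < min r s" "Z A (ball y (min r s))" "Z B (ball y (min r s))"
        using mono[OF _ subset_refl subset_ball] by (simp, meson min.cobounded1, meson min.cobounded2)
      then show ?thesis
        using un_left[OF \<open>open A\<close>] by blast
    qed
    show "\<exists>r>0. \<exists>s>0. Z (ball x r) (ball y s)" if "x \<in> X" for x
      using loc[OF that y] by blast
  qed
  with Y have "Z X Y"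
  proof (rule_tac compact_additive_property[where P = "\<lambda>Y. Z X Y"])
    show "Z X {}" using Z0 by (simp add: Z_def)
    show "Z X A" if "Z X B" "A \<subseteq> B" for A B
      using that mono by blast
  qed (auto intro: un_right)
  with u v show ?thesis by (simp add: Z_def)
qed

text \<open>Far apart translates of \<open>u\<close>, with phases chosen such that their transforms agree at \<open>l\<close>, are
  orthogonal for \<open>Q\<close>. The squared coefficient at \<open>l\<close> of the sum of \<open>n\<close> of them grows like \<open>n\<^sup>2\<close>, its
  energy only like \<open>n\<close>.\<close>

lemma ft_eq_0:
  assumes u: "bdd_fun_on S u" and l: "l \<in> \<Lambda>"
  shows "ft u l = 0"
proof -
  define q where "q = (\<lambda>u. \<Sum>\<^sub>\<infinity>l\<in>\<Lambda>. (norm (ft u l))\<^sup>2)"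
  obtain r where r: "0 < r" "{x. u x \<noteq> 0} \<subseteq> ball 0 r"
    using u bounded_subset_ballD[of "{x. u x \<noteq> 0}" 0] by (auto simp: bdd_fun_on_def)
  have ur: "bdd_fun_on (cball 0 r) u"
    using u r(2) by (force simp: bdd_fun_on_def)
  \<comment> \<open>Supports of radius \<open>r\<close> whose centres are at least \<open>L\<close>
    apart leave a gap of at least \<open>\<bar>R\<bar> + 1\<close>.\<close>
  define L where "L = 2 * r + \<bar>R\<bar> + 1"
  obtain e :: 'a where e: "norm e = L"
    by (rule vector_choose_size[of L]) (use r(1) in \<open>auto simp: L_def\<close>)
  define t where "t = (\<lambda>n. real n *\<^sub>R e)"
  \<comment> \<open>The constant phase undoes the factor that the translation by \<open>t n\<close>
    produces at the frequency \<open>l\<close>. At other frequencies only the modulus is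
    preserved.\<close>
  define f where "f = (\<lambda>n x. cnj (character l (t n)) * u (x - t n))"
  have f: "bdd_fun_on ((\<lambda>x. x + t n) ` cball 0 r) (f n)" for n
    unfolding f_def by (intro bdd_fun_on_scale bdd_fun_on_translate ur)
  have ft_f: "ft (f n) k = cnj (character l (t n)) * (character k (t n) * ft u k)" for n k
    unfolding f_def by (simp only: ft_scale ft_translate[OF ur])
  have ft_fl: "ft (f n) l = ft u l" for n
  proof -
    have "ft (f n) l = (character l (t n) * cnj (character l (t n))) * ft u l"
      unfolding ft_f by (simp only: mult_ac)
    then show ?thesis by (simp add: cnj_character)
  qed
  have q_f: "q (f n) = q u" for n
    by (simp add: q_def ft_f norm_mult)
  \<comment> \<open>The support bound is carried along to keep the next translate, centred at
    distance \<open>real (Suc n) * L\<close> from 0, far from all earlier ones.\<close>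
  have main: "bdd_fun_on (cball 0 (real n * L + r)) (\<lambda>x. \<Sum>i\<le>n. f i x) \<and>
      ft (\<lambda>x. \<Sum>i\<le>n. f i x) l = of_nat (Suc n) * ft u l \<and>
      q (\<lambda>x. \<Sum>i\<le>n. f i x) = real (Suc n) * q u" for n
  proof (induction n)
    case 0
    have "bdd_fun_on (cball 0 r) (f 0)"
      using f[of 0] by (simp add: t_def)
    then show ?case
      by (simp add: ft_fl q_f)
  next
    case (Suc n)
    let ?s = "\<lambda>x. \<Sum>i\<le>n. f i x" and ?X = "cball (0::'a) (real n * L + r)"
    let ?Y = "(\<lambda>x. x + t (Suc n)) ` cball 0 r"
    have s: "bdd_fun_on ?X ?s" using Suc by blast
    note fS = f[of "Suc n"]
    have far: "R < dist x y" if xy: "x \<in> ?X" "y \<in> ?Y" for x y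
    proof -
      from xy(2) obtain z where z: "norm z \<le> r" "y = z + t (Suc n)"
        by auto
      have "norm (t (Suc n)) = real (Suc n) * L"
        by (simp add: t_def e)
      moreover have "norm (t (Suc n)) \<le> norm x + norm z + dist x y"
        unfolding z(2) dist_norm by norm
      ultimately show ?thesis
        using xy(1) z(1) by (simp add: L_def algebra_simps)
    qed
    have Y: "compact ?Y"
      by (intro compact_continuous_image continuous_intros) auto
    have D0: "D ?s (f (Suc n)) = 0"
      using far by (intro D_compact[OF _ Y _ s fS]) auto
    \<comment> \<open>A common point of the supports would be at distance 0 from itself, not more
      than \<open>R\<close>. Hence \<open>ip\<close> vanishes, and \<open>D0\<close> becomes a
      statement about \<open>Q\<close>.\<close>
    have Dfar: "?s x * cnj (f (Suc n) x) = 0" for x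
    proof (rule ccontr)
      assume "?s x * cnj (f (Suc n) x) \<noteq> 0"
      then have "x \<in> ?X" "x \<in> ?Y"
        using bdd_fun_on_eq_0[OF s, of x] bdd_fun_on_eq_0[OF fS, of x] by (fastforce, fastforce)
      from far[OF this] R_nonneg show False by simp
    qed
    have ip0: "ip ?s (f (Suc n)) = 0"
      unfolding ip_def Dfar by simp
    have Q0: "Q ?s (f (Suc n)) = 0"
      using D0 ip0 by (simp add: D_def)
    have sum: "(\<lambda>x. \<Sum>i\<le>Suc n. f i x) = (\<lambda>x. ?s x + f (Suc n) x)" by simp
    have "q (\<lambda>x. ?s x + f (Suc n) x) = q ?s + q (f (Suc n))"
      unfolding q_def by (rule infsum_ft_add_orthogonal[OF s fS Q0])
    moreover have "bdd_fun_on (cball 0 (real (Suc n) * L + r)) (\<lambda>x. ?s x + f (Suc n) x)"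
    proof (rule bdd_fun_on_add)
      have "0 \<le> L" using r(1) by (simp add: L_def)
      then show "bdd_fun_on (cball 0 (real (Suc n) * L + r)) ?s"
        by (intro bdd_fun_on_mono[OF s] subset_cball) (simp add: algebra_simps)
      have "?Y \<subseteq> cball 0 (real (Suc n) * L + r)"
      proof
        fix y assume "y \<in> ?Y"
        then obtain z where z: "norm z \<le> r" "y = z + t (Suc n)" by auto
        have "norm y \<le> norm z + norm (t (Suc n))"
          unfolding z(2) by (rule norm_triangle_ineq)
        also have "norm (t (Suc n)) = real (Suc n) * L"
          by (simp add: t_def e)
        finally show "y \<in> cball 0 (real (Suc n) * L + r)"
          using z(1) by simp
      qed
      then show "bdd_fun_on (cball 0 (real (Suc n) * L + r)) (f (Suc n))"
        by (rule bdd_fun_on_mono[OF fS])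
    qed
    moreover have "ft (\<lambda>x. ?s x + f (Suc n) x) l = of_nat (Suc (Suc n)) * ft u l"
    proof -
      have "ft ?s l = of_nat (Suc n) * ft u l" using Suc by blast
      then show ?thesis
        unfolding ft_add[OF s fS] ft_fl by (simp add: distrib_right)
    qed
    moreover have "q ?s + q (f (Suc n)) = real (Suc (Suc n)) * q u"
    proof -
      have "q ?s = real (Suc n) * q u" using Suc by blast
      then show ?thesis
        unfolding q_f by (simp add: distrib_right)
    qed
    ultimately show ?case
      unfolding sum by (metis (lifting))
  qed
  have le: "real (Suc n) * (norm (ft u l))\<^sup>2 \<le> q u" for n
  proof -
    let ?s = "\<lambda>x. \<Sum>i\<le>n. f i x"
    have s: "bdd_fun_on (cball 0 (real n * L + r)) ?s" and fts: "ft ?s l = of_nat (Suc n) * ft u l"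
      and qs: "q ?s = real (Suc n) * q u"
      using main[of n] by blast+
    have "(\<Sum>k\<in>{l}. (norm (ft ?s k))\<^sup>2) \<le> q ?s"
      unfolding q_def using l by (intro finite_sum_le_infsum summable[OF s]) auto
    then have "(norm (ft ?s l))\<^sup>2 \<le> q ?s" by simp
    then have "(real (Suc n))\<^sup>2 * (norm (ft u l))\<^sup>2 \<le> real (Suc n) * q u"
      unfolding fts qs norm_mult norm_of_nat power_mult_distrib .
    then show ?thesis
      by (simp add: power2_eq_square mult.assoc del: of_nat_Suc)
  qed
  have "\<not> 0 < (norm (ft u l))\<^sup>2"
  proof
    assume "0 < (norm (ft u l))\<^sup>2"
    then obtain n where "q u < of_nat n * (norm (ft u l))\<^sup>2"
      using ex_less_of_nat_mult by blast
    also have "\<dots> \<le> real (Suc n) * (norm (ft u l))\<^sup>2"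
      by (intro mult_right_mono) auto
    finally show False using le[of n] by simp
  qed
  then show ?thesis by simp
qed

text \<open>The indicator of a small ball has all coefficients 0, whereas \<open>D u u = 0\<close>
  equates their energy with \<open>A\<close> times the positive volume of the ball.\<close>

lemma no_tight_frame: False
proof -
  obtain b :: 'a where "norm b = \<bar>R\<bar> + 1"
    by (rule vector_choose_size[of "\<bar>R\<bar> + 1"]) auto
  then have "R < dist 0 b" by simp
  from covered[OF this] obtain r where r: "0 < r" "nearly_covered \<Omega> (ball 0 r)"
    by (meson nearly_covered_mono sup_ge1)
  define u where "u = (indicator (ball (0::'a) r) :: 'a \<Rightarrow> complex)"
  have u: "bdd_fun_on (ball 0 r) u"
    unfolding bdd_fun_on_def
  proof (intro conjI)
    show "u \<in> borel_measurable borel"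
      unfolding u_def by (intro borel_measurable_indicator) simp
    show "bounded (range u)" by (auto simp: u_def bounded_iff indicator_def intro!: exI[of _ 1])
    show "{x. u x \<noteq> 0} \<subseteq> ball 0 r" by (auto simp: u_def indicator_def)
    then show "bounded {x. u x \<noteq> 0}" by (rule bounded_subset[OF bounded_ball])
  qed
  have "D u u = 0"
    by (rule D_nearly_covered[OF r(2) _ u u]) simp
  moreover have "Q u u = 0"
    using ft_eq_0[OF u] by (simp add: Q_def cong: infsum_cong)
  ultimately have "nrm2 u = 0"
    using A_pos by (simp add: D_def ip_self)
  moreover have "nrm2 u = measure lborel (ball (0::'a) r)"
  proof -
    have "(norm (u x))\<^sup>2 = indicator (ball 0 r) x" for x
      by (simp add: u_def indicator_def)
    then show ?thesis by (simp add: nrm2_def)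
  qed
  ultimately show False
    using content_ball_pos[OF r(1), of "0::'a"] by simp
qed

end

section \<open>Passage from \<open>L2_functions\<close> to Borel functions, and the theorem\<close>

lemma integral_lebesgue_on_bdd_fun_on:
  fixes u :: "'a::euclidean_space \<Rightarrow> 'b::{banach, second_countable_topology}"
  assumes \<Omega>: "\<Omega> \<in> sets lebesgue" and u: "bdd_fun_on \<Omega> u"
  shows "integrable (lebesgue_on \<Omega>) u"
    and "(LINT x|lebesgue_on \<Omega>. u x) = (LINT x|lborel. u x)"
proof -
  have m: "u \<in> borel_measurable lborel"
    using bdd_fun_on_measurable[OF u] by simp
  have eq: "(\<lambda>x. indicator \<Omega> x *\<^sub>R u x) = u"
    using bdd_fun_on_eq_0[OF u] by (auto simp: indicator_def fun_eq_iff)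
  show "integrable (lebesgue_on \<Omega>) u"
    using \<Omega> bdd_fun_on_integrable[OF u]
    by (simp add: integrable_restrict_space eq integrable_completion[OF m])
  show "(LINT x|lebesgue_on \<Omega>. u x) = (LINT x|lborel. u x)"
    using \<Omega> by (simp add: integral_restrict_space eq integral_completion[OF m])
qed

theorem theorem1p3:
  fixes \<Omega> :: "(real ^ 'd) set"
  assumes "\<Omega> \<in> sets lebesgue"
    and "emeasure lebesgue \<Omega> < \<infinity>"
    and "\<exists>R>0. \<forall>x :: real ^ 'd. norm x > R \<longrightarrow>
           emeasure lebesgue (\<Omega> \<inter> (\<lambda>y. y + x) ` \<Omega>) > 0"
  shows "\<not> (\<exists>\<Lambda>. tight_fourier_frame \<Omega> \<Lambda>)"
proof
  assume "\<exists>\<Lambda>. tight_fourier_frame \<Omega> \<Lambda>"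
  then obtain \<Lambda> A where A: "0 < A"
    and frame: "\<And>f. f \<in> L2_functions \<Omega> \<Longrightarrow> ((\<lambda>l. (norm (fourier_coeff \<Omega> f l))\<^sup>2) has_sum
              (A * (LINT x|lebesgue_on \<Omega>. (norm (f x))\<^sup>2))) \<Lambda>"
    unfolding tight_fourier_frame_def by blast
  obtain R where R: "0 < R"
    "\<And>x. R < norm x \<Longrightarrow> emeasure lebesgue (\<Omega> \<inter> (\<lambda>y. y + x) ` \<Omega>) > 0"
    using assms(3) by blast
  \<comment> \<open>The overlap hypothesis is used at \<open>x - y\<close>, whose norm is
    \<open>dist x y\<close>. A bounded Borel function supported in \<open>\<Omega>\<close> with
    bounded support lies in \<open>L2_functions \<Omega>\<close>, and its integrals do not change on
    passing to \<open>lborel\<close>.\<close>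
  interpret tight_frame \<Omega> \<Lambda> A R
  proof
    show "0 < A" "0 \<le> R" using A R(1) by auto
    show "\<exists>r>0. nearly_covered \<Omega> (ball x r \<union> ball y r)" if "R < dist x y" for x y
      using nearly_covered_two_balls[OF assms(1,2) R(2)[of "x - y"]] that
      unfolding dist_norm by blast
    fix u :: "real ^ 'd \<Rightarrow> complex" assume u: "bdd_fun_on \<Omega> u"
    have "u \<in> borel_measurable lebesgue"
      using bdd_fun_on_measurable[OF u] by (simp add: measurable_completion)
    then have "u \<in> borel_measurable (lebesgue_on \<Omega>)"
      by (rule measurable_restrict_space1)
    then have "u \<in> L2_functions \<Omega>"
      using integral_lebesgue_on_bdd_fun_on(1)[OF assms(1) bdd_fun_on_norm_power2[OF u]]
      by (simp add: L2_functions_def)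
    moreover have "fourier_coeff \<Omega> u l = ft u l" for l
      unfolding fourier_coeff_def ft_def character_def[symmetric]
      by (rule integral_lebesgue_on_bdd_fun_on(2)[OF assms(1) bdd_fun_on_character[OF u]])
    moreover have "(LINT x|lebesgue_on \<Omega>. (norm (u x))\<^sup>2) = nrm2 u"
      unfolding nrm2_def
      by (rule integral_lebesgue_on_bdd_fun_on(2)[OF assms(1) bdd_fun_on_norm_power2[OF u]])
    ultimately show "((\<lambda>l. (norm (ft u l))\<^sup>2) has_sum A * nrm2 u) \<Lambda>"
      using frame[of u] by simp
  qed
  show False by (rule no_tight_frame)
qed

end
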